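(* Let $G$ be a graph with (exactly) $l$ universal vertices such that $\mathrm{box}(G)=\theta(\overline{G})$, where $\overline{G}$ is the complement of $G$, and let $M(G)$ be the Mycielski graph of $G$. Then $$\mathrm{box}(G)+\left\lceil \frac{l}{2}\right\rceil \leq \mathrm{box}(M(G))\leq \mathrm{box}(G)+\left\lceil \frac{l}{2}\right\rceil+1 .$$ Moreover, if $l$ is zero or odd, then $$\mathrm{box}(M(G))=\mathrm{box}(G)+\left\lceil \frac{l}{2}\right\rceil .$$
   Context: All graphs are finite, simple and undirected. A vertex $v$ of $G$ is universal if $v$ is adjacent to all vertices in $V(G)\setminus\{v\}$. $\lceil x\rceil$ denotes the smallest integer at least $x$. A clique of a graph $H$ is a subset of $V(H)$ that induces a complete subgraph. The edge clique cover number $\theta(H)$ is the minimum cardinality of a family of cliques of $H$ that covers all edges of $H$ (each edge has both endpoints in some clique of the family); it is $0$ if $H$ has no edges. Boxicity: a box in Euclidean $k$-space is a Cartesian product $I_1\times\cdots\times I_k$ where each $I_j$ is a closed interval on the real line. The boxicity $\mathrm{box}(G)$ is the minimum nonnegative integer $k$ such that $G$ can be represented as the intersection graph of a family of boxes $(B_v)_{v\in V(G)}$ in Euclidean $k$-space, i.e. for distinct vertices $u,v$, $uv\in E(G)$ if and only if $B_u\cap B_v\neq\emptyset$. The boxicity of a complete graph is defined to be $0$. Mycielski graph: let $V(G)_1,V(G)_2$ be two disjoint copies of $V(G)$, where $v_i\in V(G)_i$ denotes the copy of $v\in V(G)$, and let $z$ be a new vertex. $M(G)$ has vertex set $\{z\}\cup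 V(G)_1\cup V(G)_2$ (disjoint union) and edge set $E_1\cup E_2\cup E_3$, where $E_1=\{u_1v_1 \mid uv\in E(G)\}$, $E_2=\{u_1v_2,\, v_1u_2 \mid uv\in E(G)\}$, $E_3=\{zu_2\mid u\in V(G)\}$. *)

theory Defs
  imports Complex_Main "HOL-Library.FuncSet" "Graph_Theory.Pair_Digraph"
begin

text \<open>
  A finite simple undirected graph is a \<^locale>\<open>pair_graph\<close>: finitely many vertices and a
  symmetric irreflexive arc relation, an undirected edge \<open>uv\<close> being the two arcs \<open>(u, v)\<close>
  and \<open>(v, u)\<close>.
\<close>

definition graph_complement :: "'a pair_pre_digraph \<Rightarrow> 'a pair_pre_digraph" where
  "graph_complement G =
     \<lparr>pverts = pverts G,
      parcs = {(u, v). u \<in> pverts G \<and> v \<in> pverts G \<and> u \<noteq> v \<and> (u, v) \<notin> parcs G}\<rparr>"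

definition universal_vertices :: "'a pair_pre_digraph \<Rightarrow> 'a set" where
  "universal_vertices G = {v \<in> pverts G. \<forall>u \<in> pverts G - {v}. (v, u) \<in> parcs G}"

definition is_clique :: "'a pair_pre_digraph \<Rightarrow> 'a set \<Rightarrow> bool" where
  "is_clique H C \<longleftrightarrow> C \<subseteq> pverts H \<and> (\<forall>u\<in>C. \<forall>v\<in>C. u \<noteq> v \<longrightarrow> (u, v) \<in> parcs H)"

definition is_edge_clique_cover :: "'a pair_pre_digraph \<Rightarrow> 'a set set \<Rightarrow> bool" where
  "is_edge_clique_cover H F \<longleftrightarrow>
     (\<forall>C\<in>F. is_clique H C) \<and> (\<forall>(u, v) \<in> parcs H. \<exists>C\<in>F. u \<in> C \<and> v \<in> C)"

definition edge_clique_cover_number :: "'a pair_pre_digraph \<Rightarrow> nat" where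
  "edge_clique_cover_number H = (LEAST n. \<exists>F. finite F \<and> card F = n \<and> is_edge_clique_cover H F)"

text \<open>
  A point of \<open>k\<close>-space is an extensional function on \<open>{..<k}\<close>. Intervals are nonempty and
  compact. For \<open>k = 0\<close> the only box is the whole one-point space.
\<close>
definition is_box :: "nat \<Rightarrow> (nat \<Rightarrow> real) set \<Rightarrow> bool" where
  "is_box k S \<longleftrightarrow> (\<exists>a b. (\<forall>j<k. a j \<le> b j) \<and> S = (\<Pi>\<^sub>E j\<in>{..<k}. {a j..b j}))"

definition is_box_representation ::
  "'a pair_pre_digraph \<Rightarrow> nat \<Rightarrow> ('a \<Rightarrow> (nat \<Rightarrow> real) set) \<Rightarrow> bool" where
  "is_box_representation G k B \<longleftrightarrow>
     (\<forall>v \<in> pverts G. is_box k (B v)) \<and>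
     (\<forall>u \<in> pverts G. \<forall>v \<in> pverts G. u \<noteq> v \<longrightarrow> ((u, v) \<in> parcs G \<longleftrightarrow> B u \<inter> B v \<noteq> {}))"

text \<open>
  Dimension \<open>0\<close> is allowed; it represents exactly the complete graphs, so the convention that
  complete graphs have boxicity \<open>0\<close> needs no separate clause.
\<close>
definition boxicity :: "'a pair_pre_digraph \<Rightarrow> nat" where
  "boxicity G = (LEAST k. \<exists>B. is_box_representation G k B)"

datatype 'a mycielski_vertex = Apex | Copy1 'a | Copy2 'a

definition mycielski :: "'a pair_pre_digraph \<Rightarrow> 'a mycielski_vertex pair_pre_digraph" where
  "mycielski G =
     \<lparr>pverts = {Apex} \<union> Copy1 ` pverts G \<union> Copy2 ` pverts G,
      parcs = {(Copy1 u, Copy1 v) | u v. (u, v) \<in> parcs G}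
            \<union> {(Copy1 u, Copy2 v) | u v. (u, v) \<in> parcs G}
            \<union> {(Copy2 u, Copy1 v) | u v. (u, v) \<in> parcs G}
            \<union> {(Apex, Copy2 u) | u. u \<in> pverts G}
            \<union> {(Copy2 u, Apex) | u. u \<in> pverts G}\<rparr>"

lemma pair_graph_iff:
  "pair_graph G \<longleftrightarrow> finite (pverts G) \<and> parcs G \<subseteq> pverts G \<times> pverts G \<and> sym (parcs G) \<and>
     irrefl (parcs G)"
proof
  assume "pair_graph G"
  then interpret pair_graph G .
  show "finite (pverts G) \<and> parcs G \<subseteq> pverts G \<times> pverts G \<and> sym (parcs G) \<and> irrefl (parcs G)"
    using pair_finite_verts
    by (auto simp: irrefl_def sym_def dest: wellformed' no_loops' arcs_symmetric)
next
  assume *: "finite (pverts G) \<and> parcs G \<subseteq> pverts G \<times> pverts G \<and> sym (parcs G) \<and> irrefl (parcs G)"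
  then have "finite (parcs G)" by (meson finite_SigmaI finite_subset)
  with * show "pair_graph G"
    by unfold_locales (auto simp: irrefl_def symmetric_def)
qed

lemma pair_graph_complement: "pair_graph G \<Longrightarrow> pair_graph (graph_complement G)"
  by (auto simp: pair_graph_iff graph_complement_def sym_def irrefl_def)

lemma pair_graph_mycielski: "pair_graph G \<Longrightarrow> pair_graph (mycielski G)"
  by (auto simp: pair_graph_iff mycielski_def sym_def irrefl_def)

lemma edge_clique_cover_exists:
  assumes "pair_graph H"
  shows "\<exists>F. finite F \<and> is_edge_clique_cover H F"
proof -
  have "finite (parcs H)" "sym (parcs H)" "parcs H \<subseteq> pverts H \<times> pverts H"
    using assms by (auto simp: pair_graph_iff intro: finite_subset)
  then have "finite ((\<lambda>(u, v). {u, v}) ` parcs H)"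
    "is_edge_clique_cover H ((\<lambda>(u, v). {u, v}) ` parcs H)"
    by (force simp: is_edge_clique_cover_def is_clique_def sym_def)+
  then show ?thesis by blast
qed

lemma box_inter_nonempty_iff:
  fixes a b c d :: "nat \<Rightarrow> real"
  assumes "\<forall>j<k. a j \<le> b j" "\<forall>j<k. c j \<le> d j"
  shows "(\<Pi>\<^sub>E j\<in>{..<k}. {a j..b j}) \<inter> (\<Pi>\<^sub>E j\<in>{..<k}. {c j..d j}) \<noteq> {} \<longleftrightarrow>
    (\<forall>j<k. a j \<le> d j \<and> c j \<le> b j)"
  using assms by (auto simp: PiE_Int PiE_eq_empty_iff)

lemma box_representation_exists:
  assumes "pair_graph G"
  shows "\<exists>k B. is_box_representation G k B"
proof -
  have fin: "finite (pverts G)" and sym: "sym (parcs G)" using assms by (auto simp: pair_graph_iff)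
  from ex_bij_betw_finite_nat[OF fin] obtain h where
    h: "bij_betw h (pverts G) {0..<card (pverts G)}" by blast
  define k where "k = card (pverts G)"
  define g where "g = inv_into (pverts G) h"
  have gh: "g (h v) = v" "h v < k" if "v \<in> pverts G" for v
    using h that by (auto simp: g_def k_def bij_betw_def)
  have gin: "g j \<in> pverts G" if "j < k" for j
    using h that by (auto simp: g_def k_def bij_betw_def intro: inv_into_into)
  define a where "a w j = (if w = g j \<or> (w, g j) \<in> parcs G then 0 else 1 :: real)" for w j
  define b where "b w j = (if w = g j then 0 else 1 :: real)" for w j
  have ab: "\<forall>j<k. a w j \<le> b w j" for w by (auto simp: a_def b_def)
  have "is_box_representation G k (\<lambda>w. \<Pi>\<^sub>E j\<in>{..<k}. {a w j..b w j})"
    unfolding is_box_representation_def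
  proof (intro conjI ballI impI)
    fix v show "is_box k (\<Pi>\<^sub>E j\<in>{..<k}. {a v j..b v j})"
      unfolding is_box_def using ab by blast
  next
    fix u v assume uv: "u \<in> pverts G" "v \<in> pverts G" "u \<noteq> v"
    have "(u, v) \<in> parcs G \<longleftrightarrow> (\<forall>j<k. a u j \<le> b v j \<and> a v j \<le> b u j)" (is "_ \<longleftrightarrow> ?R")
    proof
      assume "(u, v) \<in> parcs G"
      moreover from this have "(v, u) \<in> parcs G" using sym by (auto dest: symD)
      ultimately show ?R by (auto simp: a_def b_def)
    next
      assume ?R
      then have "a u (h v) \<le> b v (h v)" using gh uv by blast
      then show "(u, v) \<in> parcs G" using gh uv by (auto simp: a_def b_def split: if_splits)
    qed
    then show "(u, v) \<in> parcs G \<longleftrightarrow>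
      (\<Pi>\<^sub>E j\<in>{..<k}. {a u j..b u j}) \<inter> (\<Pi>\<^sub>E j\<in>{..<k}. {a v j..b v j}) \<noteq> {}"
      using box_inter_nonempty_iff[OF ab ab] by simp
  qed
  then show ?thesis by blast
qed

lemma boxicity_eq_0_iff:
  assumes "pair_graph G"
  shows "boxicity G = 0 \<longleftrightarrow> (\<forall>u \<in> pverts G. \<forall>v \<in> pverts G. u \<noteq> v \<longrightarrow> (u, v) \<in> parcs G)"
proof -
  have "boxicity G = 0 \<longleftrightarrow> (\<exists>B. is_box_representation G 0 B)"
    unfolding boxicity_def using box_representation_exists[OF assms]
    by (smt (verit, best) LeastI_ex Least_eq_0)
  also have "\<dots> \<longleftrightarrow> (\<forall>u \<in> pverts G. \<forall>v \<in> pverts G. u \<noteq> v \<longrightarrow> (u, v) \<in> parcs G)"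
    by (auto simp: is_box_representation_def is_box_def)
  finally show ?thesis .
qed

end

theory Submission
  imports Defs
begin

text \<open>
  A box representation of dimension \<open>k\<close> is a list of \<open>k\<close> assignments of intervals to the
  vertices; each of them keeps adjacent vertices overlapping, and each non-adjacent pair is
  separated by at least one of them. Both bounds count such interval layouts of the Mycielski
  graph.

  Lower bound. For a universal vertex \<open>u\<close> the two copies of \<open>u\<close> are non-adjacent, so some layout
  separates them. Every \<^term>\<open>Copy1 v\<close> with \<open>v \<noteq> u\<close> is adjacent to both copies, hence covers
  the gap between them; so this layout separates no two first copies and is of no use for
  representing \<open>G\<close> (\<open>gap_layout_merges_first_copies\<close>). Moreover a layout can
  separate the copies of at most one universal vertex in each of the two orientations
  (\<open>gap_orientation_inj\<close>). So at least \<open>l / 2\<close> layouts are spent on the universal vertices,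
  and the remaining ones, restricted to the first copies, still represent \<open>G\<close>.

  Upper bound. A clique of the complement is an independent set \<open>C\<close> of \<open>G\<close>. One layout
  (\<open>clique_layout\<close>) spreads the first copies of \<open>C\<close> as points on the negative side and its second
  copies as points on the positive side, where also the apex lives. If the sets \<open>C\<close> cover the
  complement, every non-universal vertex is in one of them, and all
  non-adjacent pairs of the Mycielski graph that involve a copy of a non-universal vertex are
  separated. The remaining pairs only concern the universal
  vertices and the apex. A layout can deal with the copies of two universal vertices at once
  (\<open>pair_layout\<close>), but then the apex, which reaches both second copies, must meet the two
  first copies. One more layout (\<open>apex_layout\<close>) separates the apex from all first copies, and it
  can also take care of a single universal vertex. This gives \<open>\<lfloor>l / 2\<rfloor> + 1\<close> extra layouts for
  \<open>l > 0\<close>, which is \<open>\<lceil>l / 2\<rceil>\<close> if \<open>l\<close> is odd; and none is needed for \<open>l = 0\<close>.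

  The lower bound is in terms of the boxicity of \<open>G\<close>, the upper one in terms of the edge clique
  cover number of the complement; when these numbers agree, the bounds differ by
  at most one, and coincide for odd \<open>l\<close> and for \<open>l = 0\<close>.
\<close>

section \<open>Boxicity as a number of interval layouts\<close>

definition overlap :: "('v \<Rightarrow> real \<times> real) \<Rightarrow> 'v \<Rightarrow> 'v \<Rightarrow> bool" where
  "overlap f u v \<longleftrightarrow> fst (f u) \<le> snd (f v) \<and> fst (f v) \<le> snd (f u)"

definition interval_layout :: "'v pair_pre_digraph \<Rightarrow> ('v \<Rightarrow> real \<times> real) \<Rightarrow> bool" where
  "interval_layout G f \<longleftrightarrow>
     (\<forall>v \<in> pverts G. fst (f v) \<le> snd (f v)) \<and> (\<forall>(u, v) \<in> parcs G. overlap f u v)"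

definition separating_layouts ::
  "'v pair_pre_digraph \<Rightarrow> ('v \<Rightarrow> real \<times> real) set \<Rightarrow> bool" where
  "separating_layouts G J \<longleftrightarrow>
     (\<forall>f \<in> J. interval_layout G f) \<and>
     (\<forall>u \<in> pverts G. \<forall>v \<in> pverts G. u \<noteq> v \<longrightarrow> (u, v) \<notin> parcs G \<longrightarrow>
        (\<exists>f \<in> J. \<not> overlap f u v))"

lemma overlap_commute: "overlap f u v \<longleftrightarrow> overlap f v u"
  by (auto simp: overlap_def)

lemma boxicity_le_card_layouts:
  assumes J: "finite J" "separating_layouts G J"
  shows "boxicity G \<le> card J"
proof -
  define k where "k = card J"
  obtain g where g: "bij_betw g {0..<k} J"
    unfolding k_def using ex_bij_betw_nat_finite[OF J(1)] by blast
  then have gJ: "g ` {..<k} = J" by (simp add: bij_betw_def atLeast0LessThan)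
  define B where "B v = (\<Pi>\<^sub>E j\<in>{..<k}. {fst (g j v)..snd (g j v)})" for v
  have le: "\<forall>j<k. fst (g j v) \<le> snd (g j v)" if "v \<in> pverts G" for v
  proof (intro allI impI)
    fix j assume "j < k"
    then have "g j \<in> J" using gJ by blast
    then show "fst (g j v) \<le> snd (g j v)"
      using J(2) that by (simp add: separating_layouts_def interval_layout_def)
  qed
  have "is_box_representation G k B"
    unfolding is_box_representation_def
  proof (intro conjI ballI impI)
    fix v assume "v \<in> pverts G"
    then show "is_box k (B v)"
      unfolding is_box_def B_def using le
      by (intro exI[of _ "\<lambda>j. fst (g j v)"] exI[of _ "\<lambda>j. snd (g j v)"]) simp
  next
    fix u v assume uv: "u \<in> pverts G" "v \<in> pverts G" "u \<noteq> v"
    have "B u \<inter> B v \<noteq> {} \<longleftrightarrow> (\<forall>j<k. overlap (g j) u v)"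
      unfolding B_def overlap_def by (rule box_inter_nonempty_iff[OF le le]) (use uv in auto)
    also have "\<dots> \<longleftrightarrow> (\<forall>f\<in>J. overlap f u v)" using gJ by blast
    also have "\<dots> \<longleftrightarrow> (u, v) \<in> parcs G"
    proof
      assume "\<forall>f\<in>J. overlap f u v"
      then show "(u, v) \<in> parcs G" using J(2) uv unfolding separating_layouts_def by metis
    next
      assume "(u, v) \<in> parcs G"
      then show "\<forall>f\<in>J. overlap f u v"
        using J(2) by (auto simp: separating_layouts_def interval_layout_def)
    qed
    finally show "(u, v) \<in> parcs G \<longleftrightarrow> B u \<inter> B v \<noteq> {}" by simp
  qed
  then have "\<exists>B. is_box_representation G k B" by (intro exI[of _ B])
  then show ?thesis unfolding boxicity_def k_def by (rule Least_le)
qed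

lemma separating_layouts_of_boxicity:
  assumes G: "pair_graph G"
  obtains J where "finite J" "card J \<le> boxicity G" "separating_layouts G J"
proof -
  define k where "k = boxicity G"
  have "\<exists>B. is_box_representation G k B"
    unfolding k_def boxicity_def using box_representation_exists[OF G] by (rule LeastI_ex)
  then obtain B where B: "is_box_representation G k B" by blast
  then have "\<forall>v \<in> pverts G. \<exists>a b. (\<forall>j<k. a j \<le> b j) \<and> B v = (\<Pi>\<^sub>E j\<in>{..<k}. {a j..b j})"
    by (simp add: is_box_representation_def is_box_def)
  then obtain a b where ab: "\<And>v. v \<in> pverts G \<Longrightarrow> \<forall>j<k. a v j \<le> b v j"
    and Bv: "\<And>v. v \<in> pverts G \<Longrightarrow> B v = (\<Pi>\<^sub>E j\<in>{..<k}. {a v j..b v j})"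
    by metis
  define g where "g j v = (a v j, b v j)" for j :: nat and v
  have adj: "(u, v) \<in> parcs G \<longleftrightarrow> (\<forall>j<k. overlap (g j) u v)"
    if "u \<in> pverts G" "v \<in> pverts G" "u \<noteq> v" for u v
  proof -
    have "(u, v) \<in> parcs G \<longleftrightarrow> B u \<inter> B v \<noteq> {}"
      using B that by (simp add: is_box_representation_def)
    also have "\<dots> \<longleftrightarrow> (\<forall>j<k. overlap (g j) u v)"
      unfolding Bv[OF that(1)] Bv[OF that(2)] box_inter_nonempty_iff[OF ab ab, OF that(1,2)]
      by (simp add: overlap_def g_def)
    finally show ?thesis .
  qed
  have arcs: "u \<in> pverts G" "v \<in> pverts G" "u \<noteq> v" if "(u, v) \<in> parcs G" for u v
    using G that by (auto simp: pair_graph_iff irrefl_def)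
  have "separating_layouts G (g ` {..<k})"
    unfolding separating_layouts_def
  proof (intro conjI ballI impI)
    fix f assume "f \<in> g ` {..<k}"
    then obtain j where j: "j < k" "f = g j" by blast
    have "overlap f u v" if "(u, v) \<in> parcs G" for u v
      using adj[OF arcs[OF that]] that j by blast
    moreover have "fst (f v) \<le> snd (f v)" if "v \<in> pverts G" for v
      using ab[OF that] j by (simp add: g_def)
    ultimately show "interval_layout G f" by (auto simp: interval_layout_def)
  next
    fix u v assume "u \<in> pverts G" "v \<in> pverts G" "u \<noteq> v" "(u, v) \<notin> parcs G"
    then obtain j where "j < k" "\<not> overlap (g j) u v" using adj by metis
    then show "\<exists>f\<in>g ` {..<k}. \<not> overlap f u v" by blast
  qed
  moreover have "card (g ` {..<k}) \<le> k" using card_image_le[of "{..<k}" g] by simp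
  ultimately show thesis by (intro that[of "g ` {..<k}"]) (simp_all add: k_def)
qed

section \<open>The lower bound\<close>

lemma mycielski_vertices [simp]:
  "Apex \<in> pverts (mycielski G)"
  "Copy1 v \<in> pverts (mycielski G) \<longleftrightarrow> v \<in> pverts G"
  "Copy2 v \<in> pverts (mycielski G) \<longleftrightarrow> v \<in> pverts G"
  by (auto simp: mycielski_def)

lemma mycielski_arcs [simp]:
  "(Copy1 u, Copy1 v) \<in> parcs (mycielski G) \<longleftrightarrow> (u, v) \<in> parcs G"
  "(Copy1 u, Copy2 v) \<in> parcs (mycielski G) \<longleftrightarrow> (u, v) \<in> parcs G"
  "(Copy2 u, Copy1 v) \<in> parcs (mycielski G) \<longleftrightarrow> (u, v) \<in> parcs G"
  "(Apex, Copy2 v) \<in> parcs (mycielski G) \<longleftrightarrow> v \<in> pverts G"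
  "(Copy2 v, Apex) \<in> parcs (mycielski G) \<longleftrightarrow> v \<in> pverts G"
  "(Apex, Apex) \<notin> parcs (mycielski G)"
  "(Apex, Copy1 v) \<notin> parcs (mycielski G)"
  "(Copy1 v, Apex) \<notin> parcs (mycielski G)"
  "(Copy2 u, Copy2 v) \<notin> parcs (mycielski G)"
  by (auto simp: mycielski_def)

lemma universal_vertices_subset: "universal_vertices G \<subseteq> pverts G"
  by (auto simp: universal_vertices_def)

lemma universal_adjacent:
  assumes "pair_graph G" "u \<in> universal_vertices G" "v \<in> pverts G" "u \<noteq> v"
  shows "(u, v) \<in> parcs G" "(v, u) \<in> parcs G"
  using assms by (auto simp: universal_vertices_def pair_graph_iff dest: symD)

text \<open>
  All first copies of vertices other than \<open>u\<close> reach both copies of \<open>u\<close> and therefore contain the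
  gap between these; and \<^term>\<open>Copy1 u\<close> is adjacent to all other first copies anyway.
\<close>
lemma gap_layout_merges_first_copies:
  assumes G: "pair_graph G" and u: "u \<in> universal_vertices G"
    and f: "interval_layout (mycielski G) f" "\<not> overlap f (Copy1 u) (Copy2 u)"
    and vw: "v \<in> pverts G" "w \<in> pverts G" "v \<noteq> w"
  shows "overlap f (Copy1 v) (Copy1 w)"
proof -
  have arc: "overlap f x y" if "(x, y) \<in> parcs (mycielski G)" for x y
    using f(1) that unfolding interval_layout_def by blast
  show ?thesis
  proof (cases "v = u \<or> w = u")
    case True
    then have "(v, w) \<in> parcs G" using universal_adjacent[OF G u] vw by metis
    then show ?thesis by (simp add: arc)
  next
    case False
    have "overlap f (Copy1 x) (Copy1 u) \<and> overlap f (Copy1 x) (Copy2 u)"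
      if "x \<in> pverts G" "x \<noteq> u" for x
      using universal_adjacent[OF G u that(1)] that by (auto intro: arc)
    from this[of v] this[of w] False vw f(2) show ?thesis by (auto simp: overlap_def)
  qed
qed

text \<open>
  If \<^term>\<open>Copy1 u\<close> lies left of \<^term>\<open>Copy2 u\<close>, and likewise for \<open>w\<close>, then the adjacencies
  between the copies of \<open>u\<close> and those of \<open>w\<close> give a cyclic chain of inequalities with strict
  steps; the reversed orientation is symmetric.
\<close>
lemma gap_orientation_inj:
  assumes G: "pair_graph G" and u: "u \<in> universal_vertices G" and w: "w \<in> universal_vertices G"
    and f: "interval_layout (mycielski G) f"
    and gaps: "\<not> overlap f (Copy1 u) (Copy2 u)" "\<not> overlap f (Copy1 w) (Copy2 w)"
    and same: "snd (f (Copy1 u)) < fst (f (Copy2 u)) \<longleftrightarrow> snd (f (Copy1 w)) < fst (f (Copy2 w))"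
  shows "u = w"
proof (rule ccontr)
  assume "u \<noteq> w"
  moreover have "w \<in> pverts G" using w universal_vertices_subset by (rule subsetD[rotated])
  ultimately have "(u, w) \<in> parcs G" "(w, u) \<in> parcs G"
    using universal_adjacent[OF G u] by simp_all
  then have "(Copy1 u, Copy2 w) \<in> parcs (mycielski G)" "(Copy1 w, Copy2 u) \<in> parcs (mycielski G)"
    by simp_all
  then have "overlap f (Copy1 u) (Copy2 w)" "overlap f (Copy1 w) (Copy2 u)"
    using f unfolding interval_layout_def by blast+
  then show False using gaps same unfolding overlap_def by linarith
qed

lemma boxicity_mycielski_lower_bound:
  assumes G: "pair_graph G"
  shows "2 * boxicity G + card (universal_vertices G) \<le> 2 * boxicity (mycielski G)"
proof -
  let ?M = "mycielski G" and ?U = "universal_vertices G"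
  obtain J where J: "finite J" "card J \<le> boxicity ?M" "separating_layouts ?M J"
    using separating_layouts_of_boxicity[OF pair_graph_mycielski[OF G]] .
  have lay: "interval_layout ?M f" if "f \<in> J" for f
    using J(3) that by (simp add: separating_layouts_def)
  have sep: "\<exists>f\<in>J. \<not> overlap f x y"
    if "x \<in> pverts ?M" "y \<in> pverts ?M" "x \<noteq> y" "(x, y) \<notin> parcs ?M" for x y
    using J(3) that by (simp add: separating_layouts_def)
  have irr: "(v, v) \<notin> parcs G" for v using G by (auto simp: pair_graph_iff irrefl_def)
  have "\<exists>f\<in>J. \<not> overlap f (Copy1 u) (Copy2 u)" if "u \<in> ?U" for u
    using subsetD[OF universal_vertices_subset that] irr by (intro sep) simp_all
  then obtain s where s: "\<And>u. u \<in> ?U \<Longrightarrow> s u \<in> J \<and> \<not> overlap (s u) (Copy1 u) (Copy2 u)"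
    by metis
  define S where "S = s ` ?U"
  have S: "S \<subseteq> J" unfolding S_def using s by blast
  then have fin_S: "finite S" using J(1) by (rule finite_subset)
  have "card ?U \<le> card (S \<times> (UNIV :: bool set))"
  proof (rule card_inj_on_le)
    let ?o = "\<lambda>u. (s u, snd (s u (Copy1 u)) < fst (s u (Copy2 u)))"
    show "inj_on ?o ?U"
    proof (rule inj_onI)
      fix u w assume uw: "u \<in> ?U" "w \<in> ?U" "?o u = ?o w"
      then have eq: "s w = s u" by simp
      show "u = w"
      proof (rule gap_orientation_inj[OF G uw(1,2)])
        show "interval_layout ?M (s u)" using lay s[OF uw(1)] by blast
        show "\<not> overlap (s u) (Copy1 u) (Copy2 u)" using s[OF uw(1)] by blast
        show "\<not> overlap (s u) (Copy1 w) (Copy2 w)" using s[OF uw(2)] eq by simp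
        show "snd (s u (Copy1 u)) < fst (s u (Copy2 u)) \<longleftrightarrow>
          snd (s u (Copy1 w)) < fst (s u (Copy2 w))" using uw(3) eq by simp
      qed
    qed
    show "?o ` ?U \<subseteq> S \<times> UNIV" by (auto simp: S_def)
    show "finite (S \<times> (UNIV :: bool set))" using fin_S by simp
  qed
  then have U_le: "card ?U \<le> 2 * card S" by (simp add: card_cartesian_product)
  have "separating_layouts G ((\<lambda>f. f \<circ> Copy1) ` (J - S))"
    unfolding separating_layouts_def
  proof (intro conjI ballI impI)
    fix g assume "g \<in> (\<lambda>f. f \<circ> Copy1) ` (J - S)"
    then obtain f where f: "f \<in> J" "g = f \<circ> Copy1" by blast
    have "overlap f (Copy1 u) (Copy1 v)" if "(u, v) \<in> parcs G" for u v
    proof -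
      have "(Copy1 u, Copy1 v) \<in> parcs ?M" using that by simp
      then show ?thesis using lay[OF f(1)] unfolding interval_layout_def by blast
    qed
    moreover have "fst (f (Copy1 v)) \<le> snd (f (Copy1 v))" if "v \<in> pverts G" for v
      using lay[OF f(1)] that by (simp add: interval_layout_def)
    ultimately show "interval_layout G g"
      unfolding f(2) by (auto simp: interval_layout_def overlap_def)
  next
    fix u v assume uv: "u \<in> pverts G" "v \<in> pverts G" "u \<noteq> v" "(u, v) \<notin> parcs G"
    then obtain f where f: "f \<in> J" "\<not> overlap f (Copy1 u) (Copy1 v)"
      using sep[of "Copy1 u" "Copy1 v"] by auto
    have "f \<notin> S"
    proof
      assume "f \<in> S"
      then obtain x where x: "x \<in> ?U" "f = s x" unfolding S_def by blast
      then have "\<not> overlap f (Copy1 x) (Copy2 x)" using s by blast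
      then have "overlap f (Copy1 u) (Copy1 v)"
        by (rule gap_layout_merges_first_copies[OF G x(1) lay[OF f(1)] _ uv(1-3)])
      with f(2) show False by contradiction
    qed
    then show "\<exists>g\<in>(\<lambda>f. f \<circ> Copy1) ` (J - S). \<not> overlap g u v"
      using f by (intro bexI[of _ "f \<circ> Copy1"]) (simp_all add: overlap_def)
  qed
  then have "boxicity G \<le> card ((\<lambda>f. f \<circ> Copy1) ` (J - S))"
    using J(1) by (intro boxicity_le_card_layouts) auto
  also have "\<dots> \<le> card (J - S)" using J(1) by (intro card_image_le) auto
  also have "\<dots> = card J - card S" using S fin_S by (simp add: card_Diff_subset)
  finally have "boxicity G + card S \<le> card J" using card_mono[OF J(1) S] by simp
  then show ?thesis using U_le J(2) by linarith
qed

section \<open>The upper bound\<close>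

text \<open>
  The numbering \<open>h\<close> provides distinct points for the vertices of \<open>C\<close>, which is independent in \<open>G\<close>;
  its values lie between \<open>1\<close> and \<open>n\<close>, so that the long intervals reach all these points.
\<close>
fun clique_layout :: "('a \<Rightarrow> real) \<Rightarrow> real \<Rightarrow> 'a set \<Rightarrow> 'a mycielski_vertex \<Rightarrow> real \<times> real" where
  "clique_layout h n C Apex = (0, n)"
| "clique_layout h n C (Copy1 v) = (if v \<in> C then (- h v, - h v) else (- n, n))"
| "clique_layout h n C (Copy2 v) = (if v \<in> C then (h v, h v) else (- n, 0))"

text \<open>
  The gap of \<open>u\<close> is \<open>(0, 1)\<close> and that of \<open>w\<close> is \<open>(-1, 0)\<close>, with opposite orientation: the second
  copies of \<open>u\<close> and \<open>w\<close> are the outermost points. All other second copies sit at \<open>0\<close>, where all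
  first copies meet, and are therefore separated from these two.
\<close>
fun pair_layout :: "'a \<Rightarrow> 'a \<Rightarrow> 'a mycielski_vertex \<Rightarrow> real \<times> real" where
  "pair_layout u w Apex = (-1, 1)"
| "pair_layout u w (Copy1 v) = (if v = u then (-1, 0) else if v = w then (0, 1) else (-1, 1))"
| "pair_layout u w (Copy2 v) = (if v = u then (1, 1) else if v = w then (-1, -1) else (0, 0))"

fun apex_layout :: "'a \<Rightarrow> 'a mycielski_vertex \<Rightarrow> real \<times> real" where
  "apex_layout u Apex = (2, 2)"
| "apex_layout u (Copy1 v) = (if v = u then (0, 0) else (0, 1))"
| "apex_layout u (Copy2 v) = (if v = u then (1, 2) else (0, 2))"

lemma interval_layout_mycielskiI:
  assumes G: "pair_graph G"
    and "\<And>x. x \<in> pverts (mycielski G) \<Longrightarrow> fst (f x) \<le> snd (f x)"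
    and "\<And>u v. (u, v) \<in> parcs G \<Longrightarrow> overlap f (Copy1 u) (Copy1 v)"
    and "\<And>u v. (u, v) \<in> parcs G \<Longrightarrow> overlap f (Copy1 u) (Copy2 v)"
    and "\<And>v. v \<in> pverts G \<Longrightarrow> overlap f Apex (Copy2 v)"
  shows "interval_layout (mycielski G) f"
proof -
  have "(v, u) \<in> parcs G" if "(u, v) \<in> parcs G" for u v
    using G that by (auto simp: pair_graph_iff dest: symD)
  then have "overlap f (Copy2 u) (Copy1 v)" if "(u, v) \<in> parcs G" for u v
    using assms(4) that overlap_commute by metis
  moreover have "overlap f (Copy2 v) Apex" if "v \<in> pverts G" for v
    using assms(5) that overlap_commute by metis
  ultimately have "overlap f x y" if "(x, y) \<in> parcs (mycielski G)" for x y
    using that assms(3-5) by (cases x; cases y) simp_all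
  then show ?thesis using assms(2) unfolding interval_layout_def by blast
qed

lemma interval_layout_clique:
  assumes G: "pair_graph G" and C: "is_clique (graph_complement G) C"
    and h: "\<And>v. v \<in> pverts G \<Longrightarrow> 1 \<le> h v \<and> h v \<le> n" and n: "0 \<le> n"
  shows "interval_layout (mycielski G) (clique_layout h n C)"
proof (rule interval_layout_mycielskiI[OF G])
  fix x assume "x \<in> pverts (mycielski G)"
  then show "fst (clique_layout h n C x) \<le> snd (clique_layout h n C x)"
    using n by (cases x) auto
next
  fix u v assume uv: "(u, v) \<in> parcs G"
  then have V: "u \<in> pverts G" "v \<in> pverts G" "u \<noteq> v"
    using G by (auto simp: pair_graph_iff irrefl_def)
  have "\<not> (u \<in> C \<and> v \<in> C)"
    using C uv V by (auto simp: is_clique_def graph_complement_def)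
  then show "overlap (clique_layout h n C) (Copy1 u) (Copy1 v)"
    "overlap (clique_layout h n C) (Copy1 u) (Copy2 v)"
    using h[OF V(1)] h[OF V(2)] n by (auto simp: overlap_def)
next
  fix v assume "v \<in> pverts G"
  then show "overlap (clique_layout h n C) Apex (Copy2 v)"
    using h[of v] n by (auto simp: overlap_def)
qed

lemma interval_layout_pair:
  assumes "pair_graph G" "u \<noteq> w"
  shows "interval_layout (mycielski G) (pair_layout u w)"
proof (rule interval_layout_mycielskiI[OF assms(1)])
  show "fst (pair_layout u w x) \<le> snd (pair_layout u w x)" for x by (cases x) auto
qed (use assms in \<open>auto simp: overlap_def pair_graph_iff irrefl_def\<close>)

lemma interval_layout_apex:
  assumes "pair_graph G"
  shows "interval_layout (mycielski G) (apex_layout u)"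
proof (rule interval_layout_mycielskiI[OF assms(1)])
  show "fst (apex_layout u x) \<le> snd (apex_layout u x)" for x by (cases x) auto
qed (use assms in \<open>auto simp: overlap_def pair_graph_iff irrefl_def\<close>)

lemma separating_layouts_mycielskiI:
  assumes G: "pair_graph G" and "\<And>f. f \<in> J \<Longrightarrow> interval_layout (mycielski G) f"
    and apex: "\<And>v. v \<in> pverts G \<Longrightarrow> \<exists>f\<in>J. \<not> overlap f Apex (Copy1 v)"
    and same: "\<And>v. v \<in> pverts G \<Longrightarrow> \<exists>f\<in>J. \<not> overlap f (Copy1 v) (Copy2 v)"
    and second: "\<And>u v. u \<in> pverts G \<Longrightarrow> v \<in> pverts G \<Longrightarrow> u \<noteq> v \<Longrightarrow>
      \<exists>f\<in>J. \<not> overlap f (Copy2 u) (Copy2 v)"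
    and nonadj: "\<And>u v. u \<in> pverts G \<Longrightarrow> v \<in> pverts G \<Longrightarrow> u \<noteq> v \<Longrightarrow> (u, v) \<notin> parcs G \<Longrightarrow>
      (\<exists>f\<in>J. \<not> overlap f (Copy1 u) (Copy1 v)) \<and> (\<exists>f\<in>J. \<not> overlap f (Copy1 u) (Copy2 v))"
  shows "separating_layouts (mycielski G) J"
proof -
  have mixed: "\<exists>f\<in>J. \<not> overlap f (Copy1 u) (Copy2 v)"
    if "u \<in> pverts G" "v \<in> pverts G" "(u, v) \<notin> parcs G" for u v
    using same nonadj that by (cases "u = v") auto
  have "(v, u) \<in> parcs G" if "(u, v) \<in> parcs G" for u v
    using G that by (auto simp: pair_graph_iff dest: symD)
  then have mixed': "\<exists>f\<in>J. \<not> overlap f (Copy2 u) (Copy1 v)"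
    if "u \<in> pverts G" "v \<in> pverts G" "(u, v) \<notin> parcs G" for u v
    using mixed that overlap_commute by metis
  have apex': "\<exists>f\<in>J. \<not> overlap f (Copy1 v) Apex" if "v \<in> pverts G" for v
    using apex[OF that] overlap_commute by metis
  have "\<exists>f\<in>J. \<not> overlap f x y"
    if "x \<in> pverts (mycielski G)" "y \<in> pverts (mycielski G)" "x \<noteq> y"
      "(x, y) \<notin> parcs (mycielski G)" for x y
  proof (cases x)
    case Apex
    then show ?thesis using that apex by (cases y) auto
  next
    case (Copy1 u)
    then show ?thesis using that apex' mixed nonadj by (cases y) auto
  next
    case (Copy2 u)
    then show ?thesis using that mixed' second by (cases y) auto
  qed
  then show ?thesis using assms(2) unfolding separating_layouts_def by blast
qed

lemma minimum_edge_clique_cover: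
  assumes "pair_graph H"
  obtains F where "finite F" "card F = edge_clique_cover_number H" "is_edge_clique_cover H F"
proof -
  have "\<exists>n F. finite F \<and> card F = n \<and> is_edge_clique_cover H F"
    using edge_clique_cover_exists[OF assms] by blast
  from LeastI_ex[OF this] show thesis
    using that unfolding edge_clique_cover_number_def by blast
qed

text \<open>
  The set \<open>P\<close> of extra layouts has to do what the cliques cannot do: separate the copies of
  universal vertices from each other and from the apex.
\<close>
lemma boxicity_mycielski_le_cover_plus:
  assumes G: "pair_graph G" and P: "finite P" "\<And>f. f \<in> P \<Longrightarrow> interval_layout (mycielski G) f"
    and apex: "\<And>u. u \<in> universal_vertices G \<Longrightarrow> \<exists>f\<in>P. \<not> overlap f Apex (Copy1 u)"
    and same: "\<And>u. u \<in> universal_vertices G \<Longrightarrow> \<exists>f\<in>P. \<not> overlap f (Copy1 u) (Copy2 u)"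
    and second: "\<And>u w. u \<in> universal_vertices G \<Longrightarrow> w \<in> universal_vertices G \<Longrightarrow> u \<noteq> w \<Longrightarrow>
      \<exists>f\<in>P. \<not> overlap f (Copy2 u) (Copy2 w)"
  shows "boxicity (mycielski G) \<le> edge_clique_cover_number (graph_complement G) + card P"
proof -
  let ?H = "graph_complement G" and ?U = "universal_vertices G"
  obtain F where F: "finite F" "card F = edge_clique_cover_number ?H" "is_edge_clique_cover ?H F"
    using minimum_edge_clique_cover[OF pair_graph_complement[OF G]] .
  have fin: "finite (pverts G)" using G by (simp add: pair_graph_iff)
  obtain h' where h': "bij_betw h' (pverts G) {0..<card (pverts G)}"
    using ex_bij_betw_finite_nat[OF fin] by blast
  define h where "h v = real (h' v) + 1" for v
  define n where "n = real (card (pverts G))"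
  have h: "1 \<le> h v \<and> h v \<le> n" if "v \<in> pverts G" for v
  proof -
    have "h' v < card (pverts G)" using h' that by (auto simp: bij_betw_def)
    then show ?thesis by (simp add: h_def n_def)
  qed
  have h_inj: "h u \<noteq> h v" if "u \<in> pverts G" "v \<in> pverts G" "u \<noteq> v" for u v
    using h' that by (auto simp: h_def bij_betw_def inj_on_def)
  define K where "K = clique_layout h n ` F"
  have cover: "\<exists>C\<in>F. u \<in> C \<and> v \<in> C"
    if "u \<in> pverts G" "v \<in> pverts G" "u \<noteq> v" "(u, v) \<notin> parcs G" for u v
  proof -
    have "(u, v) \<in> parcs ?H" using that by (simp add: graph_complement_def)
    then show ?thesis using F(3) unfolding is_edge_clique_cover_def by blast
  qed
  have covered: "\<exists>C\<in>F. v \<in> C" if v: "v \<in> pverts G" "v \<notin> ?U" for v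
  proof -
    obtain w where "w \<in> pverts G" "v \<noteq> w" "(v, w) \<notin> parcs G"
      using v by (auto simp: universal_vertices_def)
    then show ?thesis using cover v(1) by blast
  qed
  have second_K: "\<exists>f\<in>K. \<not> overlap f (Copy2 u) (Copy2 v)"
    if uv: "u \<in> pverts G" "v \<in> pverts G" "u \<noteq> v" "u \<notin> ?U" for u v
  proof -
    obtain C where C: "C \<in> F" "u \<in> C" using covered uv by blast
    have "\<not> overlap (clique_layout h n C) (Copy2 u) (Copy2 v)"
      using C(2) h[OF uv(1)] h_inj[OF uv(1-3)] by (auto simp: overlap_def)
    then show ?thesis using C(1) by (auto simp: K_def)
  qed
  have "separating_layouts (mycielski G) (K \<union> P)"
  proof (rule separating_layouts_mycielskiI[OF G])
    fix f assume "f \<in> K \<union> P"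
    moreover have "interval_layout (mycielski G) (clique_layout h n C)" if "C \<in> F" for C
    proof (rule interval_layout_clique[OF G _ h])
      show "is_clique ?H C" using F(3) that by (simp add: is_edge_clique_cover_def)
    qed (simp_all add: n_def)
    ultimately show "interval_layout (mycielski G) f" using P(2) by (auto simp: K_def)
  next
    fix v assume v: "v \<in> pverts G"
    have "\<exists>f\<in>K. \<not> overlap f Apex (Copy1 v) \<and> \<not> overlap f (Copy1 v) (Copy2 v)" if nu: "v \<notin> ?U"
    proof -
      obtain C where "C \<in> F" "v \<in> C" using covered[OF v nu] by blast
      then show ?thesis using h[OF v] by (auto simp: K_def overlap_def)
    qed
    then show "\<exists>f\<in>K \<union> P. \<not> overlap f Apex (Copy1 v)"
      "\<exists>f\<in>K \<union> P. \<not> overlap f (Copy1 v) (Copy2 v)"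
      using apex same by blast+
  next
    fix u v assume uv: "u \<in> pverts G" "v \<in> pverts G" "u \<noteq> v"
    show "\<exists>f\<in>K \<union> P. \<not> overlap f (Copy2 u) (Copy2 v)"
      using second second_K[OF uv] second_K[OF uv(2,1)] uv overlap_commute by (metis UnI1 UnI2)
  next
    fix u v assume uv: "u \<in> pverts G" "v \<in> pverts G" "u \<noteq> v" "(u, v) \<notin> parcs G"
    then obtain C where C: "C \<in> F" "u \<in> C" "v \<in> C" using cover by blast
    have "\<not> overlap (clique_layout h n C) (Copy1 u) (Copy1 v)"
      "\<not> overlap (clique_layout h n C) (Copy1 u) (Copy2 v)"
      using C h[OF uv(1)] h[OF uv(2)] h_inj[OF uv(1-3)] by (auto simp: overlap_def)
    then show "(\<exists>f\<in>K \<union> P. \<not> overlap f (Copy1 u) (Copy1 v)) \<and>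
        (\<exists>f\<in>K \<union> P. \<not> overlap f (Copy1 u) (Copy2 v))"
      using C(1) by (auto simp: K_def)
  qed
  then have "boxicity (mycielski G) \<le> card (K \<union> P)"
    using F(1) P(1) by (intro boxicity_le_card_layouts) (auto simp: K_def)
  also have "\<dots> \<le> card K + card P" by (rule card_Un_le)
  also have "card K \<le> card F" unfolding K_def by (rule card_image_le[OF F(1)])
  finally show ?thesis using F(2) by simp
qed

lemma boxicity_mycielski_le_no_universal:
  assumes "pair_graph G" "universal_vertices G = {}"
  shows "boxicity (mycielski G) \<le> edge_clique_cover_number (graph_complement G)"
  using boxicity_mycielski_le_cover_plus[OF assms(1), of "{}"] assms(2) by simp

text \<open>
  The universal vertices are paired off consecutively, and the last one in the enumeration is the
  one served by the layout for the apex: it is the unpaired vertex if their number is odd.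
\<close>
lemma boxicity_mycielski_le_universal:
  assumes G: "pair_graph G" and l: "card (universal_vertices G) = l" "0 < l"
  shows "boxicity (mycielski G) \<le>
    edge_clique_cover_number (graph_complement G) + (l div 2 + 1)"
proof -
  let ?U = "universal_vertices G"
  have "finite ?U" using l card_ge_0_finite by metis
  then obtain e where e: "bij_betw e {0..<l} ?U" using ex_bij_betw_nat_finite l(1) by blast
  have e_eq: "e i = e j \<longleftrightarrow> i = j" if "i < l" "j < l" for i j
    using e that by (auto simp: bij_betw_def inj_on_def)
  have e_surj: "\<exists>i<l. u = e i" if "u \<in> ?U" for u
    using bij_betw_imp_surj_on[OF e] that by force
  define D where "D = (\<lambda>i. pair_layout (e (2 * i)) (e (2 * i + 1))) ` {..<l div 2}"
  define P where "P = insert (apex_layout (e (l - 1))) D"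
  have paired: "\<exists>f\<in>P. \<not> overlap f (Copy1 (e i)) (Copy2 (e i)) \<and>
      (\<forall>w. w \<noteq> e i \<longrightarrow> \<not> overlap f (Copy2 (e i)) (Copy2 w))"
    if i: "i < l" "i \<noteq> l - 1 \<or> even l" for i
  proof -
    define a where "a = e (2 * (i div 2))"
    define b where "b = e (2 * (i div 2) + 1)"
    have lt: "2 * (i div 2) + 1 < l" using i by presburger
    then have "i div 2 < l div 2" by presburger
    then have mem: "pair_layout a b \<in> P" unfolding P_def D_def a_def b_def by blast
    have neq: "a \<noteq> b" unfolding a_def b_def using e_eq[OF _ lt] lt by simp
    have "e i = a \<or> e i = b"
    proof (cases "even i")
      case True
      then show ?thesis by (simp add: a_def)
    next
      case False
      then show ?thesis by (simp add: b_def)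
    qed
    then show ?thesis using neq by (intro bexI[OF _ mem]) (auto simp: overlap_def)
  qed
  have "boxicity (mycielski G) \<le> edge_clique_cover_number (graph_complement G) + card P"
  proof (rule boxicity_mycielski_le_cover_plus[OF G])
    show "finite P" by (simp add: P_def D_def)
  next
    fix f assume "f \<in> P"
    moreover have "e (2 * i) \<noteq> e (2 * i + 1)" if "i < l div 2" for i
      using e_eq[of "2 * i" "2 * i + 1"] that by simp
    ultimately show "interval_layout (mycielski G) f"
      using interval_layout_pair[OF G] interval_layout_apex[OF G] by (auto simp: P_def D_def)
  next
    fix u assume "u \<in> ?U"
    then obtain i where i: "i < l" "u = e i" using e_surj by blast
    show "\<exists>f\<in>P. \<not> overlap f Apex (Copy1 u)"
      by (auto simp: P_def overlap_def)
    show "\<exists>f\<in>P. \<not> overlap f (Copy1 u) (Copy2 u)"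
    proof (cases "i = l - 1")
      case True
      then show ?thesis using i by (auto simp: P_def overlap_def)
    next
      case False
      then show ?thesis using paired[of i] i by blast
    qed
  next
    fix u w assume "u \<in> ?U" "w \<in> ?U" and uw: "u \<noteq> w"
    then obtain i j where ij: "i < l" "u = e i" "j < l" "w = e j" using e_surj by metis
    \<comment> \<open>At most one of the two is the unpaired vertex.\<close>
    then have "i \<noteq> l - 1 \<or> j \<noteq> l - 1" using uw by auto
    then show "\<exists>f\<in>P. \<not> overlap f (Copy2 u) (Copy2 w)"
      using paired[of i] paired[of j] ij uw overlap_commute by metis
  qed
  moreover have "card P \<le> l div 2 + 1"
  proof -
    have "card D \<le> l div 2"
      unfolding D_def using card_image_le[of "{..<l div 2}"] by (metis card_lessThan finite_lessThan)
    moreover have "card P \<le> Suc (card D)" unfolding P_def by (rule card_insert_le_m1) simp_all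
    ultimately show ?thesis by simp
  qed
  ultimately show ?thesis by simp
qed

section \<open>Boxicity of the Mycielski graph\<close>

theorem corollary4p4:
  fixes G :: "'a pair_pre_digraph" and l :: nat
  assumes "pair_graph G"
    and "card (universal_vertices G) = l"
    and "boxicity G = edge_clique_cover_number (graph_complement G)"
  shows "int (boxicity G) + \<lceil>real l / 2\<rceil> \<le> int (boxicity (mycielski G))
       \<and> int (boxicity (mycielski G)) \<le> int (boxicity G) + \<lceil>real l / 2\<rceil> + 1
       \<and> (l = 0 \<or> odd l \<longrightarrow> int (boxicity (mycielski G)) = int (boxicity G) + \<lceil>real l / 2\<rceil>)"
proof -
  have "finite (universal_vertices G)"
    using assms(1) by (intro finite_subset[OF universal_vertices_subset]) (simp add: pair_graph_iff)
  then have zero: "boxicity (mycielski G) \<le> boxicity G" if "l = 0"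
    using boxicity_mycielski_le_no_universal[OF assms(1)] assms(2,3) that by simp
  have pos: "boxicity (mycielski G) \<le> boxicity G + (l div 2 + 1)" if "0 < l"
    using boxicity_mycielski_le_universal[OF assms(1,2) that] assms(3) by simp
  have low: "2 * boxicity G + l \<le> 2 * boxicity (mycielski G)"
    using boxicity_mycielski_lower_bound[OF assms(1)] assms(2) by simp
  show ?thesis
  proof (cases "even l")
    case True
    then obtain m where m: "l = 2 * m" by (elim evenE)
    then show ?thesis using zero pos low by (cases "m = 0") simp_all
  next
    case False
    then obtain m where m: "l = 2 * m + 1" by (elim oddE)
    have "\<lceil>real l / 2\<rceil> = int m + 1" by (rule ceiling_unique) (simp_all add: m)
    then show ?thesis using pos low m by simp
  qed
qed

end
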